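(* Let $\Bbbk$ be a field of characteristic $0$, let $n\ge2$, and let $q,q'\in\Bbbk$ be nonzero. Then $N_q\cong N_{q'}$ as Nambu-Poisson fields if and only if $q=\pm q'$.
   Context: A Nambu-Poisson algebra ($n$-Lie Poisson algebra) is a commutative $\Bbbk$-algebra $P$ with an $n$-ary $\Bbbk$-multilinear bracket $\{-,\dots,-\}$ that vanishes whenever two arguments are equal, satisfies $\{\{u_1,\dots,u_n\},v_1,\dots,v_{n-1}\}=\sum_{s=1}^n\{u_1,\dots,u_{s-1},\{u_s,v_1,\dots,v_{n-1}\},u_{s+1},\dots,u_n\}$, and satisfies the Leibniz rule in each argument. Isomorphisms are $\Bbbk$-algebra isomorphisms preserving brackets. For $q\in\Bbbk^\times$, the $q$-skew Nambu-Poisson field $N_q$ is the rational function field $\Bbbk(t_1,\dots,t_n)$ with the $n$-Lie Poisson bracket determined by $\{t_1,\dots,t_n\}=q\,t_1\cdots t_n$. *)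

theory Defs
  imports
    Complex_Main
    "HOL-Library.Poly_Mapping"
    "HOL-Computational_Algebra.Fraction_Field"
begin

section \<open>Nambu-Poisson algebras\<close>

text \<open>
  The arity of the bracket is the cardinality of a finite linearly ordered index type \<open>'n\<close>;
  an argument list \<open>(u\<^sub>1, \<dots>, u\<^sub>n)\<close> is a family \<open>u :: 'n \<Rightarrow> 'a\<close>, read along the order of \<open>'n\<close>.
\<close>

definition first_index :: "'n::{finite,linorder}" where
  "first_index = Min UNIV"

text \<open>
  In \<open>fundamental_identity\<close>, the entry of \<open>v\<close> at the first position is always overwritten, so only
  the remaining \<open>n - 1\<close> entries of \<open>v\<close> play a role: \<open>br (v(first_index := x))\<close> is
  \<open>{x, v\<^sub>1, \<dots>, v\<^sub>n\<^sub>-\<^sub>1}\<close>.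
\<close>

locale nambu_poisson_algebra =
  vector_space scale
  for scale :: "'k::field \<Rightarrow> 'a::comm_ring_1 \<Rightarrow> 'a" +
  fixes br :: "('n::{finite,linorder} \<Rightarrow> 'a) \<Rightarrow> 'a"
  assumes scale_mult_left: "scale c (x * y) = scale c x * y"
    and multilinear: "Vector_Spaces.linear scale scale (\<lambda>x. br (u(i := x)))"
    and alternating: "i \<noteq> j \<Longrightarrow> u i = u j \<Longrightarrow> br u = 0"
    and fundamental_identity:
      "br (v(first_index := br u)) = (\<Sum>s\<in>UNIV. br (u(s := br (v(first_index := u s)))))"
    and leibniz: "br (u(i := x * y)) = x * br (u(i := y)) + br (u(i := x)) * y"

definition nambu_poisson_iso ::
  "('k::field \<Rightarrow> 'a::comm_ring_1 \<Rightarrow> 'a) \<Rightarrow> (('n::{finite,linorder} \<Rightarrow> 'a) \<Rightarrow> 'a) \<Rightarrow>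
   ('k \<Rightarrow> 'b::comm_ring_1 \<Rightarrow> 'b) \<Rightarrow> (('n \<Rightarrow> 'b) \<Rightarrow> 'b) \<Rightarrow> ('a \<Rightarrow> 'b) \<Rightarrow> bool" where
  "nambu_poisson_iso scale1 br1 scale2 br2 \<phi> \<longleftrightarrow>
     bij \<phi> \<and>
     Vector_Spaces.linear scale1 scale2 \<phi> \<and>
     \<phi> 1 = 1 \<and>
     (\<forall>x y. \<phi> (x * y) = \<phi> x * \<phi> y) \<and>
     (\<forall>u. \<phi> (br1 u) = br2 (\<lambda>i. \<phi> (u i)))"

definition nambu_poisson_isomorphic ::
  "('k::field \<Rightarrow> 'a::comm_ring_1 \<Rightarrow> 'a) \<Rightarrow> (('n::{finite,linorder} \<Rightarrow> 'a) \<Rightarrow> 'a) \<Rightarrow>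
   ('k \<Rightarrow> 'b::comm_ring_1 \<Rightarrow> 'b) \<Rightarrow> (('n \<Rightarrow> 'b) \<Rightarrow> 'b) \<Rightarrow> bool" where
  "nambu_poisson_isomorphic scale1 br1 scale2 br2 \<longleftrightarrow>
     (\<exists>\<phi>. nambu_poisson_iso scale1 br1 scale2 br2 \<phi>)"

section \<open>The rational function field\<close>

text \<open>
  \<open>'n \<Rightarrow>\<^sub>0 nat\<close> is the type of monomials (exponent vectors), and \<open>('n \<Rightarrow>\<^sub>0 nat) \<Rightarrow>\<^sub>0 'k\<close>, with the
  convolution product of the library, is the polynomial ring over \<open>'k\<close> in variables indexed by
  \<open>'n\<close>. The order on \<open>'n\<close> also serves the library instance that makes this ring an integral domain.
\<close>

type_synonym ('n, 'k) ratfun = "(('n \<Rightarrow>\<^sub>0 nat) \<Rightarrow>\<^sub>0 'k) fract"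

definition ratfun_var :: "'n::{finite,linorder} \<Rightarrow> ('n, 'k::field) ratfun" where
  "ratfun_var i = Fract (Poly_Mapping.single (Poly_Mapping.single i 1) 1) 1"

definition ratfun_const :: "'k::field \<Rightarrow> ('n::{finite,linorder}, 'k) ratfun" where
  "ratfun_const c = Fract (Poly_Mapping.single 0 c) 1"

definition ratfun_scale ::
  "'k::field \<Rightarrow> ('n::{finite,linorder}, 'k) ratfun \<Rightarrow> ('n, 'k) ratfun" where
  "ratfun_scale c f = ratfun_const c * f"

section \<open>The $q$-skew Nambu-Poisson fields\<close>

text \<open>
  Such a bracket exists, namely \<open>q t\<^sub>1 \<cdots> t\<^sub>n\<close> times the Jacobian determinant, and is unique because
  it is a derivation in each argument and so is determined by its values on the generators.
\<close>

definition qskew_bracket ::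
  "'k::field \<Rightarrow> ('n::{finite,linorder} \<Rightarrow> ('n, 'k) ratfun) \<Rightarrow> ('n, 'k) ratfun" where
  "qskew_bracket q =
     (THE br. nambu_poisson_algebra ratfun_scale br \<and>
        br ratfun_var = ratfun_scale q (\<Prod>i\<in>UNIV. ratfun_var i))"

end

theory Submission
  imports Defs "HOL-Analysis.Determinants"
begin

text \<open>
  Let \<open>\<theta>\<^sub>j = t\<^sub>j \<partial>/\<partial>t\<^sub>j\<close> be the Euler derivations. The bracket of \<open>N\<^sub>q\<close> is \<open>q det (\<theta>\<^sub>j u\<^sub>i)\<close>; the fundamental
  identity holds because the \<open>\<theta>\<^sub>j\<close> commute and the cofactors of a Jacobian matrix are divergence free.
  Evaluating an isomorphism \<open>N\<^sub>q \<rightarrow> N\<^sub>q\<^sub>'\<close> on \<open>{t\<^sub>1, \<dots>, t\<^sub>n}\<close>, with \<open>f\<^sub>i\<close> the image of \<open>t\<^sub>i\<close>, gives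
  \<open>q = q' det (\<theta>\<^sub>j f\<^sub>i / f\<^sub>i)\<close>. For a monomial order, \<open>\<theta>\<^sub>j f / f\<close> is the exponent of \<open>t\<^sub>j\<close> in the leading
  monomial of \<open>f\<close> plus terms of lower order, so the constant \<open>q / q'\<close> is an integer determinant. The
  same applies to \<open>q' / q\<close>, whence \<open>q = \<plusminus> q'\<close>. Conversely, exchanging two variables is an
  isomorphism \<open>N\<^sub>-\<^sub>q \<rightarrow> N\<^sub>q\<close>.
\<close>

section \<open>Derivations\<close>

definition derivation :: "('a::comm_ring_1 \<Rightarrow> 'a) \<Rightarrow> bool" where
  "derivation D \<longleftrightarrow> (\<forall>x y. D (x + y) = D x + D y) \<and> (\<forall>x y. D (x * y) = x * D y + D x * y)"

lemma derivationI:
  assumes "\<And>x y. D (x + y) = D x + D y" and "\<And>x y. D (x * y) = x * D y + D x * y"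
  shows "derivation D"
  using assms by (simp add: derivation_def)

lemma derivation_add: "derivation D \<Longrightarrow> D (x + y) = D x + D y"
  by (simp add: derivation_def)

lemma derivation_mult: "derivation D \<Longrightarrow> D (x * y) = x * D y + D x * y"
  by (simp add: derivation_def)

lemma derivation_0: "derivation D \<Longrightarrow> D 0 = 0"
  using derivation_add[of D 0 0] by simp

lemma derivation_1: "derivation D \<Longrightarrow> D 1 = 0"
  using derivation_mult[of D 1 1] by simp

lemma derivation_minus: "derivation D \<Longrightarrow> D (- x) = - D x"
  using derivation_add[of D x "- x"] by (simp add: derivation_0 eq_neg_iff_add_eq_0 add.commute)

lemma derivation_sum: "derivation D \<Longrightarrow> D (sum f A) = (\<Sum>i\<in>A. D (f i))"
  by (induction A rule: infinite_finite_induct) (simp_all add: derivation_0 derivation_add)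

lemma derivation_of_nat: "derivation D \<Longrightarrow> D (of_nat n) = 0"
  by (induction n) (simp_all add: derivation_0 derivation_1 derivation_add)

lemma derivation_of_int: "derivation D \<Longrightarrow> D (of_int n) = 0"
  by (cases n rule: int_cases2) (simp_all add: derivation_of_nat derivation_minus)

text \<open>The differentiated factor is marked by a case distinction inside the full product, so
  that in \<open>derivation_det\<close> every summand is again a Leibniz term of a determinant with
  one row differentiated.\<close>

lemma derivation_prod:
  assumes D: "derivation D" and "finite A"
  shows "D (prod f A) = (\<Sum>s\<in>A. \<Prod>i\<in>A. if i = s then D (f i) else f i)"
  using assms(2)
proof induction
  case empty
  then show ?case by (simp add: derivation_1[OF D])
next
  case (insert a A)
  have "D (prod f (insert a A)) = f a * D (prod f A) + D (f a) * prod f A"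
    using insert by (simp add: derivation_mult[OF D])
  also have "D (f a) * prod f A = (\<Prod>i\<in>insert a A. if i = a then D (f i) else f i)"
    using insert by (auto intro!: arg_cong2[where f = "(*)"] prod.cong)
  also have "f a * D (prod f A) = (\<Sum>s\<in>A. \<Prod>i\<in>insert a A. if i = s then D (f i) else f i)"
    unfolding insert.IH sum_distrib_left using insert.hyps
    by (auto intro!: sum.cong)
  finally show ?case using insert.hyps by (simp add: add.commute)
qed

text \<open>In \<open>D (E (x * y))\<close> the mixed terms \<open>D x * E y\<close> and
  \<open>E x * D y\<close> are symmetric in \<open>D\<close> and \<open>E\<close>, so they cancel in
  the commutator.\<close>

lemma derivation_commutator:
  assumes "derivation D" "derivation E"
  shows "derivation (\<lambda>x. D (E x) - E (D x))"
  by (rule derivationI) (use assms in \<open>simp_all add: derivation_add derivation_mult algebra_simps\<close>)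

lemma derivation_minus_derivation:
  assumes "derivation D" "derivation E"
  shows "derivation (\<lambda>x. D x - E x)"
  by (rule derivationI) (use assms in \<open>simp_all add: derivation_add derivation_mult algebra_simps\<close>)

section \<open>Extension of derivations and ring maps to the fraction field\<close>

definition fract_deriv :: "('a::idom \<Rightarrow> 'a) \<Rightarrow> 'a fract \<Rightarrow> 'a fract" where
  "fract_deriv D x = (SOME y. \<exists>a b. b \<noteq> 0 \<and> x = Fract a b \<and> y = Fract (b * D a - a * D b) (b * b))"

text \<open>The quotient rule does not depend on the representative: applying \<open>D\<close> to
  \<open>a * d = c * b\<close> gives a second equation, and the two together yield the
  cross-multiplied identity.\<close>

lemma fract_deriv_Fract:
  assumes D: "derivation D" and b: "b \<noteq> 0"
  shows "fract_deriv D (Fract a b) = Fract (b * D a - a * D b) (b * b)"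
  unfolding fract_deriv_def
proof (rule some_equality)
  show "\<exists>a' b'. b' \<noteq> 0 \<and> Fract a b = Fract a' b' \<and>
    Fract (b * D a - a * D b) (b * b) = Fract (b' * D a' - a' * D b') (b' * b')"
    using b by blast
next
  fix y assume "\<exists>a' b'. b' \<noteq> 0 \<and> Fract a b = Fract a' b' \<and> y = Fract (b' * D a' - a' * D b') (b' * b')"
  then obtain c d where d: "d \<noteq> 0" and eq: "Fract a b = Fract c d"
    and y: "y = Fract (d * D c - c * D d) (d * d)" by blast
  have 1: "a * d = c * b" using eq b d by (simp add: eq_fract)
  then have "D (a * d) = D (c * b)" by simp
  then have 2: "a * D d + D a * d = c * D b + D c * b" by (simp add: derivation_mult[OF D])
  have "(b * D a - a * D b) * (d * d) = (d * D c - c * D d) * (b * b)"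
    using 1 2 by algebra
  then show "y = Fract (b * D a - a * D b) (b * b)"
    using b d by (simp add: y eq_fract)
qed

lemma derivation_fract_deriv:
  assumes D: "derivation D"
  shows "derivation (fract_deriv D)"
proof (rule derivationI)
  fix x y :: "'a fract"
  obtain a b where x: "x = Fract a b" "b \<noteq> 0" by (cases x)
  obtain c d where y: "y = Fract c d" "d \<noteq> 0" by (cases y)
  show "fract_deriv D (x + y) = fract_deriv D x + fract_deriv D y"
    using x y by (simp add: fract_deriv_Fract[OF D] derivation_add[OF D] derivation_mult[OF D] eq_fract algebra_simps)
  show "fract_deriv D (x * y) = x * fract_deriv D y + fract_deriv D x * y"
    using x y by (simp add: fract_deriv_Fract[OF D] derivation_add[OF D] derivation_mult[OF D] eq_fract algebra_simps)
qed

text \<open>Apply \<open>D\<close> to \<open>b * x = a\<close> for \<open>x = a / b\<close>: what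
  remains is \<open>b * D x = 0\<close>.\<close>

lemma derivation_eq_0_on_fract:
  fixes D :: "'a::idom fract \<Rightarrow> 'a fract"
  assumes D: "derivation D" and 0: "\<And>p. D (Fract p 1) = 0"
  shows "D x = 0"
proof (cases x)
  case (Fract a b)
  have "Fract b 1 * x = Fract a 1" using Fract by (simp add: eq_fract)
  then have "D (Fract b 1 * x) = 0" using 0 by simp
  then have "Fract b 1 * D x = 0" by (simp add: derivation_mult[OF D] 0)
  moreover have "Fract b 1 \<noteq> 0" using Fract by (simp add: Zero_fract_def eq_fract)
  ultimately show ?thesis by simp
qed

definition fract_map :: "('a::idom \<Rightarrow> 'b::idom) \<Rightarrow> 'a fract \<Rightarrow> 'b fract" where
  "fract_map h x = (SOME y. \<exists>a b. b \<noteq> 0 \<and> x = Fract a b \<and> y = Fract (h a) (h b))"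

lemma fract_map_Fract:
  assumes mult: "\<And>x y. h (x * y) = h x * h y" and nz: "\<And>x. x \<noteq> 0 \<Longrightarrow> h x \<noteq> 0" and b: "b \<noteq> 0"
  shows "fract_map h (Fract a b) = Fract (h a) (h b)"
  unfolding fract_map_def
proof (rule some_equality)
  show "\<exists>a' b'. b' \<noteq> 0 \<and> Fract a b = Fract a' b' \<and> Fract (h a) (h b) = Fract (h a') (h b')"
    using b by blast
next
  fix y assume "\<exists>a' b'. b' \<noteq> 0 \<and> Fract a b = Fract a' b' \<and> y = Fract (h a') (h b')"
  then obtain c d where d: "d \<noteq> 0" and eq: "Fract a b = Fract c d" and y: "y = Fract (h c) (h d)" by blast
  have "h (a * d) = h (c * b)" using eq b d by (simp add: eq_fract)
  then show "y = Fract (h a) (h b)"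
    using b d by (simp add: y eq_fract nz mult)
qed

section \<open>Polynomials\<close>

text \<open>Reduces additive statements to single terms, the zero element being a term with
  coefficient \<open>0\<close>. It serves both polynomials and their exponent vectors, which are
  finitely supported maps as well.\<close>

lemma poly_mapping_add_induct [case_names single add]:
  assumes single: "\<And>k c. P (Poly_Mapping.single k c)"
    and add: "\<And>p q. P p \<Longrightarrow> P q \<Longrightarrow> P (p + q)"
  shows "P (p :: 'a \<Rightarrow>\<^sub>0 'b::comm_monoid_add)"
proof (induction p rule: Poly_Mapping.update_induct)
  case const
  show ?case using single[of undefined 0] by simp
next
  case (update p k c)
  have "Poly_Mapping.update k c p = p + Poly_Mapping.single k c"
    using update by (intro poly_mapping_eqI)
      (auto simp: lookup_update lookup_add lookup_single when_def in_keys_iff)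
  then show ?case using update single add by simp
qed

text \<open>The operator \<open>t\<^sub>j \<partial>/\<partial>t\<^sub>j\<close>. Being diagonal on
  monomials, it shifts no exponent, so bounds on the leading monomial survive it.\<close>

definition poly_euler :: "'n \<Rightarrow> (('n \<Rightarrow>\<^sub>0 nat) \<Rightarrow>\<^sub>0 'k::comm_ring_1) \<Rightarrow> ('n \<Rightarrow>\<^sub>0 nat) \<Rightarrow>\<^sub>0 'k" where
  "poly_euler j p = Poly_Mapping.mapp (\<lambda>m c. of_nat (Poly_Mapping.lookup m j) * c) p"

lemma lookup_poly_euler: "Poly_Mapping.lookup (poly_euler j p) m = of_nat (Poly_Mapping.lookup m j) * Poly_Mapping.lookup p m"
  by (simp add: poly_euler_def lookup_mapp when_def in_keys_iff)

lemma poly_euler_single: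
  "poly_euler j (Poly_Mapping.single m c) = Poly_Mapping.single m (of_nat (Poly_Mapping.lookup m j) * c)"
  by (rule poly_mapping_eqI) (simp add: lookup_poly_euler lookup_single when_def)

lemma poly_euler_add: "poly_euler j (p + q) = poly_euler j p + poly_euler j q"
  by (rule poly_mapping_eqI) (simp add: lookup_poly_euler lookup_add algebra_simps)

lemma derivation_poly_euler: "derivation (poly_euler j)"
proof (rule derivationI)
  show "poly_euler j (p * q) = p * poly_euler j q + poly_euler j p * q" for p q :: "('a \<Rightarrow>\<^sub>0 nat) \<Rightarrow>\<^sub>0 'b"
  proof (induction p rule: poly_mapping_add_induct)
    case (single k c)
    show ?case
    proof (induction q rule: poly_mapping_add_induct)
      case (single l d)
      show ?case
        by (simp add: mult_single poly_euler_single lookup_add flip: single_add)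
          (simp add: algebra_simps)
    next
      case (add p q)
      then show ?case by (simp add: poly_euler_add algebra_simps)
    qed
  next
    case (add p q)
    then show ?case by (simp add: poly_euler_add algebra_simps)
  qed
qed (rule poly_euler_add)

text \<open>The inner \<open>map_key\<close> permutes the entries of an exponent vector, the outer
  one transports coefficients along that map. \<open>map_key\<close> is precomposition with an
  injective map; for the involutions used below this agrees with substituting
  \<open>\<tau> i\<close> for the variable \<open>i\<close>.\<close>

definition poly_permute :: "('n \<Rightarrow> 'n) \<Rightarrow> (('n \<Rightarrow>\<^sub>0 nat) \<Rightarrow>\<^sub>0 'k::zero) \<Rightarrow> ('n \<Rightarrow>\<^sub>0 nat) \<Rightarrow>\<^sub>0 'k" where
  "poly_permute \<tau> = Poly_Mapping.map_key (Poly_Mapping.map_key \<tau>)"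

context
  fixes \<tau> :: "'n \<Rightarrow> 'n"
  assumes invol: "\<And>i. \<tau> (\<tau> i) = i"
begin

lemma inj_invol: "inj \<tau>"
  by (metis injI invol)

lemma map_key_invol: "Poly_Mapping.map_key \<tau> (Poly_Mapping.map_key \<tau> m) = m"
  by (rule poly_mapping_eqI) (simp add: Poly_Mapping.map_key.rep_eq inj_invol invol)

lemma inj_map_key_invol: "inj (Poly_Mapping.map_key \<tau> :: ('n \<Rightarrow>\<^sub>0 nat) \<Rightarrow> _)"
  by (metis injI map_key_invol)

lemma poly_permute_invol: "poly_permute \<tau> (poly_permute \<tau> p) = p"
  unfolding poly_permute_def
  by (rule poly_mapping_eqI) (simp add: Poly_Mapping.map_key.rep_eq inj_map_key_invol map_key_invol)

lemma poly_permute_single: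
  "poly_permute \<tau> (Poly_Mapping.single m c) = Poly_Mapping.single (Poly_Mapping.map_key \<tau> m) c"
  unfolding poly_permute_def
  by (rule poly_mapping_eqI)
    (simp add: Poly_Mapping.map_key.rep_eq inj_map_key_invol lookup_single when_def; metis map_key_invol)

lemma poly_permute_add:
  fixes p q :: "('n \<Rightarrow>\<^sub>0 nat) \<Rightarrow>\<^sub>0 'k::comm_ring_1"
  shows "poly_permute \<tau> (p + q) = poly_permute \<tau> p + poly_permute \<tau> q"
  unfolding poly_permute_def by (rule map_key_plus[OF inj_map_key_invol])

lemma poly_permute_mult:
  fixes p q :: "('n \<Rightarrow>\<^sub>0 nat) \<Rightarrow>\<^sub>0 'k::comm_ring_1"
  shows "poly_permute \<tau> (p * q) = poly_permute \<tau> p * poly_permute \<tau> q"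
proof (induction p rule: poly_mapping_add_induct)
  case (single k c)
  show ?case
  proof (induction q rule: poly_mapping_add_induct)
    case (single l d)
    show ?case
      by (simp add: mult_single poly_permute_single map_key_plus[OF inj_invol])
  next
    case (add p q)
    then show ?case by (simp add: poly_permute_add algebra_simps)
  qed
next
  case (add p q)
  then show ?case by (simp add: poly_permute_add algebra_simps)
qed

end

section \<open>Rational functions\<close>

lemma ratfun_const_0 [simp]: "ratfun_const 0 = 0"
  by (simp add: ratfun_const_def Zero_fract_def)

lemma ratfun_const_1 [simp]: "ratfun_const 1 = 1"
  by (simp add: ratfun_const_def One_fract_def)

lemma ratfun_const_add: "ratfun_const (c + d) = ratfun_const c + ratfun_const d"
  by (simp add: ratfun_const_def single_add)

lemma ratfun_const_mult: "ratfun_const (c * d) = ratfun_const c * ratfun_const d"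
  by (simp add: ratfun_const_def mult_single)

lemma ratfun_const_minus: "ratfun_const (- c) = - ratfun_const c"
  by (simp add: ratfun_const_def single_uminus)

lemma ratfun_const_eq_0_iff [simp]: "ratfun_const c = 0 \<longleftrightarrow> c = 0"
  by (auto simp: ratfun_const_def Zero_fract_def eq_fract dest: arg_cong[where f = "\<lambda>p. Poly_Mapping.lookup p 0"])

text \<open>A use of characteristic \<open>0\<close>: the constant \<open>1 + 1\<close> is
  invertible. Symmetric-antisymmetric contractions of second derivatives vanish for this
  reason.\<close>

lemma ratfun_double_eq_0:
  fixes x :: "('n::{finite,linorder}, 'k::field_char_0) ratfun"
  assumes "x + x = 0"
  shows "x = 0"
proof -
  have "ratfun_const (1 + 1) * x = x + x"
    unfolding ratfun_const_add by (simp add: algebra_simps)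
  then show ?thesis using assms by simp
qed

lemma ratfun_var_neq_0 [simp]: "ratfun_var i \<noteq> 0"
  by (auto simp: ratfun_var_def Zero_fract_def eq_fract
      dest: arg_cong[where f = "\<lambda>p. Poly_Mapping.lookup p (Poly_Mapping.single i 1)"])

lemma vector_space_ratfun_scale: "vector_space (ratfun_scale :: 'k::field \<Rightarrow> ('n::{finite,linorder}, 'k) ratfun \<Rightarrow> _)"
  by unfold_locales (simp_all add: ratfun_scale_def ratfun_const_add ratfun_const_mult algebra_simps)

text \<open>The main way of proving identities between derivations: their difference is a
  derivation, to be checked on constants and variables only. The Leibniz rule carries the vanishing
  to monomials, terms, polynomials and fractions in turn.\<close>

lemma ratfun_derivation_eq_0:
  fixes D :: "('n::{finite,linorder}, 'k::field) ratfun \<Rightarrow> ('n, 'k) ratfun"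
  assumes D: "derivation D" and const: "\<And>c. D (ratfun_const c) = 0" and var: "\<And>i. D (ratfun_var i) = 0"
  shows "D x = 0"
proof (rule derivation_eq_0_on_fract[OF D])
  \<comment> \<open>Induction on the exponent vector: sums of exponent vectors are products of
    monomials, and a power of one variable is built up factor by factor.\<close>
  have mono: "D (Fract (Poly_Mapping.single m 1) 1) = 0" for m :: "'n \<Rightarrow>\<^sub>0 nat"
  proof (induction m rule: poly_mapping_add_induct)
    case (single k e)
    show ?case
    proof (induction e)
      case 0
      show ?case using derivation_1[OF D] by (simp add: One_fract_def)
    next
      case (Suc e)
      have "Fract (Poly_Mapping.single (Poly_Mapping.single k (Suc e)) (1::'k)) 1
        = ratfun_var k * Fract (Poly_Mapping.single (Poly_Mapping.single k e) 1) 1"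
        by (simp add: ratfun_var_def mult_single flip: single_add)
      then show ?case by (simp only: derivation_mult[OF D] Suc var) simp
    qed
  next
    case (add p q)
    have "Fract (Poly_Mapping.single (p + q) (1::'k)) 1
      = Fract (Poly_Mapping.single p 1) 1 * Fract (Poly_Mapping.single q 1) 1"
      by (simp add: mult_single)
    then show ?case by (simp only: derivation_mult[OF D] add) simp
  qed
  fix p :: "('n \<Rightarrow>\<^sub>0 nat) \<Rightarrow>\<^sub>0 'k"
  show "D (Fract p 1) = 0"
  proof (induction p rule: poly_mapping_add_induct)
    case (single m c)
    have "Fract (Poly_Mapping.single m c) 1 = ratfun_const c * Fract (Poly_Mapping.single m 1) 1"
      by (simp add: ratfun_const_def mult_single)
    then show ?case by (simp only: derivation_mult[OF D] const mono) simp
  next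
    case (add p q)
    have "Fract (p + q) 1 = Fract p 1 + Fract q 1" by simp
    then show ?case by (simp only: derivation_add[OF D] add) simp
  qed
qed

section \<open>Euler derivations of the rational function field\<close>

definition euler :: "'n::{finite,linorder} \<Rightarrow> ('n, 'k::field) ratfun \<Rightarrow> ('n, 'k) ratfun" where
  "euler j = fract_deriv (poly_euler j)"

lemma derivation_euler: "derivation (euler j)"
  unfolding euler_def by (rule derivation_fract_deriv[OF derivation_poly_euler])

lemma euler_const [simp]: "euler j (ratfun_const c) = 0"
  by (simp add: euler_def ratfun_const_def fract_deriv_Fract[OF derivation_poly_euler]
      poly_euler_single derivation_1[OF derivation_poly_euler] Zero_fract_def)

lemma euler_var: "euler j (ratfun_var i) = (if i = j then ratfun_var i else 0)"
  by (simp add: euler_def ratfun_var_def fract_deriv_Fract[OF derivation_poly_euler]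
      poly_euler_single derivation_1[OF derivation_poly_euler] Zero_fract_def lookup_single when_def)

lemma euler_commute: "euler i (euler j x) = euler j (euler i x)"
proof -
  have "euler i (euler j x) - euler j (euler i x) = 0"
    by (rule ratfun_derivation_eq_0[OF derivation_commutator])
      (simp_all add: derivation_euler euler_var derivation_0)
  then show ?thesis by simp
qed

lemma euler_const_mult: "euler j (ratfun_const c * x) = ratfun_const c * euler j x"
  by (simp add: derivation_mult[OF derivation_euler])

section \<open>Jacobian determinants\<close>

text \<open>Laplace expansion along row \<open>i\<close>, with each cofactor kept as a full
  determinant whose row \<open>i\<close> is a unit vector. This avoids submatrices and their
  signs.\<close>

lemma det_expand_row:
  fixes A :: "'a::comm_ring_1^'n^'n"
  shows "det (\<chi> k. if k = i then r else A $ k) =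
    (\<Sum>j\<in>UNIV. r $ j * det (\<chi> k. if k = i then axis j 1 else A $ k))"
proof -
  have r: "r = (\<Sum>j\<in>UNIV. r $ j *s axis j 1)"
    by (simp add: basis_expansion)
  have "det (\<chi> k. if k = i then r else A $ k) =
      det (\<chi> k. if k = i then (\<Sum>j\<in>UNIV. r $ j *s axis j 1) else A $ k)"
    by (rule arg_cong[OF r])
  also have "\<dots> = (\<Sum>j\<in>UNIV. det (\<chi> k. if k = i then r $ j *s axis j 1 else A $ k))"
    by (rule det_linear_row_sum) simp
  also have "\<dots> = (\<Sum>j\<in>UNIV. r $ j * det (\<chi> k. if k = i then axis j 1 else A $ k))"
    by (intro sum.cong refl det_row_mul)
  finally show ?thesis .
qed

text \<open>Differentiate the Leibniz formula term by term; the signs are integers and have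
  derivative \<open>0\<close>.\<close>

lemma derivation_det:
  fixes A :: "'a::comm_ring_1^'n^'n"
  assumes D: "derivation D"
  shows "D (det A) = (\<Sum>s\<in>UNIV. det (\<chi> k. if k = s then (\<chi> l. D (A $ s $ l)) else A $ k))"
proof -
  have "D (det A) = (\<Sum>p | p permutes UNIV. of_int (sign p) *
      (\<Sum>s\<in>UNIV. \<Prod>i\<in>UNIV. if i = s then D (A $ i $ p i) else A $ i $ p i))"
    by (simp add: det_def derivation_sum[OF D] derivation_mult[OF D] derivation_of_int[OF D]
        derivation_prod[OF D])
  also have "\<dots> = (\<Sum>s\<in>UNIV. \<Sum>p | p permutes UNIV. of_int (sign p) *
      (\<Prod>i\<in>UNIV. if i = s then D (A $ i $ p i) else A $ i $ p i))"
    unfolding sum_distrib_left by (rule sum.swap)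
  also have "\<dots> = (\<Sum>s\<in>UNIV. det (\<chi> k. if k = s then (\<chi> l. D (A $ s $ l)) else A $ k))"
    unfolding det_def by (intro sum.cong refl arg_cong2[where f = "(*)"] prod.cong) auto
  finally show ?thesis .
qed

text \<open>Both sides replace one factor in each Leibniz term. The factor is named by its row
  \<open>i\<close> on the left and by its column \<open>p i\<close> on the right, and
  \<open>p\<close> is a bijection.\<close>

lemma sum_det_replace_row_eq_column:
  fixes A V :: "'a::comm_ring_1^'n^'n"
  shows "(\<Sum>s\<in>UNIV. det (\<chi> k. if k = s then V $ k else A $ k)) =
    (\<Sum>l\<in>UNIV. det (\<chi> i j. if j = l then V $ i $ j else A $ i $ j))"
proof -
  have "(\<Sum>s\<in>UNIV. det (\<chi> k. if k = s then V $ k else A $ k)) =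
    (\<Sum>p | p permutes UNIV. \<Sum>s\<in>UNIV. of_int (sign p) *
      (\<Prod>i\<in>UNIV. if i = s then V $ i $ p i else A $ i $ p i))"
    unfolding det_def by (subst sum.swap) (intro sum.cong refl arg_cong2[where f = "(*)"] prod.cong, auto)
  also have "\<dots> = (\<Sum>p | p permutes UNIV. \<Sum>l\<in>UNIV. of_int (sign p) *
      (\<Prod>i\<in>UNIV. if p i = l then V $ i $ p i else A $ i $ p i))"
  proof (rule sum.cong[OF refl])
    fix p :: "'n \<Rightarrow> 'n" assume "p \<in> {p. p permutes UNIV}"
    then have p: "p permutes UNIV" by simp
    have "(\<Sum>l\<in>UNIV. of_int (sign p) * (\<Prod>i\<in>UNIV. if p i = l then V $ i $ p i else A $ i $ p i))
      = (\<Sum>s\<in>UNIV. of_int (sign p) * (\<Prod>i\<in>UNIV. if p i = p s then V $ i $ p i else A $ i $ p i))"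
      by (subst sum.permute[OF p]) (simp add: o_def)
    also have "\<dots> = (\<Sum>s\<in>UNIV. of_int (sign p) * (\<Prod>i\<in>UNIV. if i = s then V $ i $ p i else A $ i $ p i))"
      by (simp add: inj_eq[OF permutes_inj[OF p]])
    finally show "(\<Sum>s\<in>UNIV. of_int (sign p) * (\<Prod>i\<in>UNIV. if i = s then V $ i $ p i else A $ i $ p i)) =
       (\<Sum>l\<in>UNIV. of_int (sign p) * (\<Prod>i\<in>UNIV. if p i = l then V $ i $ p i else A $ i $ p i))" ..
  qed
  also have "\<dots> = (\<Sum>l\<in>UNIV. det (\<chi> i j. if j = l then V $ i $ j else A $ i $ j))"
    unfolding det_def by (subst sum.swap) simp
  finally show ?thesis .
qed

text \<open>This is the linear coefficient of \<open>det (A (1 + \<epsilon> B))\<close> in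
  \<open>\<epsilon>\<close>. After passing to columns, column \<open>l\<close> is
  \<open>A *v column l B\<close>, and Cramer's lemma gives the factor
  \<open>B $ l $ l\<close>.\<close>

lemma sum_det_replace_row_mult:
  fixes A B :: "'a::field^'n^'n"
  shows "(\<Sum>s\<in>UNIV. det (\<chi> k. if k = s then (A ** B) $ k else A $ k)) = trace B * det A"
proof -
  have "(\<chi> i j. if j = l then (A ** B) $ i $ j else A $ i $ j) =
    (\<chi> i j. if j = l then (A *v column l B) $ i else A $ i $ j)" for l
    by (auto simp: vec_eq_iff matrix_matrix_mult_def matrix_vector_mult_def column_def)
  then have "det (\<chi> i j. if j = l then (A ** B) $ i $ j else A $ i $ j) = B $ l $ l * det A" for l
    by (simp add: cramer_lemma) (simp add: column_def)
  then show ?thesis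
    by (simp add: sum_det_replace_row_eq_column trace_def sum_distrib_right)
qed

text \<open>Exchanging the summation indices turns the sum into its negative.\<close>

lemma sum_symmetric_antisymmetric:
  fixes H G :: "'n::finite \<Rightarrow> 'n \<Rightarrow> 'a::comm_ring_1"
  assumes double: "\<And>x::'a. x + x = 0 \<Longrightarrow> x = 0"
    and H: "\<And>k l. H k l = H l k" and G: "\<And>k l. G k l = - G l k"
  shows "(\<Sum>k\<in>UNIV. \<Sum>l\<in>UNIV. H k l * G k l) = 0"
proof (rule double)
  have "(\<Sum>k\<in>UNIV. \<Sum>l\<in>UNIV. H k l * G k l) = (\<Sum>k\<in>UNIV. \<Sum>l\<in>UNIV. H l k * G l k)"
    by (rule sum.swap)
  also have "\<dots> = (\<Sum>k\<in>UNIV. \<Sum>l\<in>UNIV. - (H k l * G k l))"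
  proof (intro sum.cong refl)
    fix k l show "H l k * G l k = - (H k l * G k l)"
      using H[of k l] G[of k l] by simp
  qed
  finally show "(\<Sum>k\<in>UNIV. \<Sum>l\<in>UNIV. H k l * G k l) + (\<Sum>k\<in>UNIV. \<Sum>l\<in>UNIV. H k l * G k l) = 0"
    by (simp add: sum_negf)
qed

text \<open>The Jacobian identities are proved from these properties alone; for a field,
  \<open>double\<close> says that the characteristic is not \<open>2\<close>.\<close>

locale commuting_derivations =
  fixes \<theta> :: "'n::finite \<Rightarrow> 'a::field \<Rightarrow> 'a"
  assumes deriv: "derivation (\<theta> i)"
    and commute: "\<theta> i (\<theta> j x) = \<theta> j (\<theta> i x)"
    and double: "x + x = (0::'a) \<Longrightarrow> x = 0"
begin

definition jac :: "('n \<Rightarrow> 'a) \<Rightarrow> 'a" where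
  "jac u = det (\<chi> i j. \<theta> j (u i))"

definition jac_cofactor :: "('n \<Rightarrow> 'a) \<Rightarrow> 'n \<Rightarrow> 'n \<Rightarrow> 'a" where
  "jac_cofactor u i j = det (\<chi> k. if k = i then axis j 1 else \<chi> l. \<theta> l (u k))"

lemma jac_update: "jac (u(i := x)) = (\<Sum>j\<in>UNIV. \<theta> j x * jac_cofactor u i j)"
proof -
  have "(\<chi> k j. \<theta> j ((u(i := x)) k)) =
    (\<chi> k. if k = i then (\<chi> j. \<theta> j x) else (\<chi> k j. \<theta> j (u k)) $ k)"
    by (simp add: vec_eq_iff)
  then have "jac (u(i := x)) =
      det (\<chi> k. if k = i then (\<chi> j. \<theta> j x) else (\<chi> k j. \<theta> j (u k)) $ k)"
    by (simp only: jac_def)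
  also have "\<dots> = (\<Sum>j\<in>UNIV. (\<chi> j. \<theta> j x) $ j *
      det (\<chi> k. if k = i then axis j 1 else (\<chi> k j. \<theta> j (u k)) $ k))"
    by (rule det_expand_row)
  finally show ?thesis
    by (simp add: jac_cofactor_def cong: if_cong)
qed

lemma derivation_jac: "derivation (\<lambda>x. jac (u(i := x)))"
  by (rule derivationI)
    (simp_all add: jac_update derivation_add[OF deriv] derivation_mult[OF deriv]
      sum.distrib sum_distrib_left sum_distrib_right algebra_simps)

lemma jac_alternating:
  assumes "i \<noteq> j" "u i = u j"
  shows "jac u = 0"
  unfolding jac_def by (rule det_identical_rows[OF assms(1)]) (simp add: row_def assms(2))

text \<open>The Hessian of each remaining \<open>u s\<close> is symmetric and enters contracted with an antisymmetric family.\<close>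

lemma jac_cofactor_divergence: "(\<Sum>k\<in>UNIV. \<theta> k (jac_cofactor u f k)) = 0"
proof -
  \<comment> \<open>Row \<open>f\<close> is the unit vector \<open>k\<close> and row
    \<open>s\<close> the unit vector \<open>l\<close>. Exchanging the two rows exchanges
    \<open>k\<close> and \<open>l\<close> at the cost of a sign.\<close>
  define G where "G s k l = det (\<chi> i. if i = s then axis l 1 else
      (\<chi> i. if i = f then axis k 1 else \<chi> l. \<theta> l (u i)) $ i)" for s k l
  have G_antisym: "G s k l = - G s l k" if "s \<noteq> f" for s k l
  proof -
    let ?p = "Transposition.transpose s f"
    let ?A = "\<lambda>k l. (\<chi> i. if i = s then axis l 1 else
      (\<chi> i. if i = f then axis k 1 else \<chi> l. \<theta> l (u i)) $ i) :: 'a^'n^'n"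
    have "?A k l = (\<chi> i. ?A l k $ ?p i)"
      using that by (auto simp: vec_eq_iff Transposition.transpose_def)
    moreover have "det (\<chi> i. ?A l k $ ?p i) = of_int (sign ?p) * det (?A l k)"
      by (rule det_permute_rows) (simp add: permutes_swap_id)
    ultimately have "G s k l = of_int (sign ?p) * G s l k"
      by (simp only: G_def)
    then show ?thesis using that by (simp add: sign_swap_id)
  qed
  have "\<theta> k (jac_cofactor u f k) = (\<Sum>s\<in>UNIV - {f}. \<Sum>l\<in>UNIV. \<theta> k (\<theta> l (u s)) * G s k l)" for k
  proof -
    let ?A = "(\<chi> i. if i = f then axis k 1 else \<chi> l. \<theta> l (u i)) :: 'a^'n^'n"
    let ?d = "\<lambda>s. det (\<chi> i. if i = s then (\<chi> l. \<theta> k (?A $ s $ l)) else ?A $ i)"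
    \<comment> \<open>Row \<open>f\<close> of the cofactor matrix is constant, so only the rows
      \<open>s \<noteq> f\<close> contribute to the derivative.\<close>
    have "(\<chi> l. \<theta> k (?A $ f $ l)) = 0"
      by (simp add: vec_eq_iff axis_def derivation_0[OF deriv] derivation_1[OF deriv])
    then have "?d f = 0" by (simp only: det_row_0)
    moreover have "?d s = (\<Sum>l\<in>UNIV. \<theta> k (\<theta> l (u s)) * G s k l)" if "s \<noteq> f" for s
      unfolding G_def by (subst det_expand_row) (use that in simp)
    ultimately show ?thesis
      unfolding jac_cofactor_def derivation_det[OF deriv]
      by (subst sum.remove[of UNIV f]) auto
  qed
  then have "(\<Sum>k\<in>UNIV. \<theta> k (jac_cofactor u f k)) =
     (\<Sum>s\<in>UNIV - {f}. \<Sum>k\<in>UNIV. \<Sum>l\<in>UNIV. \<theta> k (\<theta> l (u s)) * G s k l)"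
    by (simp only:) (rule sum.swap)
  also have "\<dots> = 0"
  proof (rule sum.neutral, rule ballI, rule sum_symmetric_antisymmetric)
    fix s k l assume "s \<in> UNIV - {f}"
    then show "G s k l = - G s l k" by (intro G_antisym) simp
    show "\<theta> k (\<theta> l (u s)) = \<theta> l (\<theta> k (u s))" by (rule commute)
  qed (rule double)
  finally show ?thesis .
qed

text \<open>
  A derivation \<open>\<Sum>\<^sub>j c\<^sub>j \<theta>\<^sub>j\<close> of divergence \<open>0\<close> acts on the Jacobian determinant argument by argument:
  the commutators with the \<open>\<theta> l\<close> contribute the divergence times the determinant.
\<close>

lemma jac_divergence_free:
  assumes c: "(\<Sum>k\<in>UNIV. \<theta> k (c k)) = 0"
    and D: "\<And>x. D x = (\<Sum>j\<in>UNIV. c j * \<theta> j x)"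
  shows "D (jac u) = (\<Sum>s\<in>UNIV. jac (u(s := D (u s))))"
proof -
  have derD: "derivation D"
    by (rule derivationI)
      (simp_all add: D derivation_add[OF deriv] derivation_mult[OF deriv]
        sum.distrib sum_distrib_left sum_distrib_right algebra_simps)
  define U :: "'a^'n^'n" where "U = (\<chi> i j. \<theta> j (u i))"
  \<comment> \<open>The Jacobian matrix of the coefficients; its trace is the divergence.\<close>
  define B :: "'a^'n^'n" where "B = (\<chi> j l. \<theta> l (c j))"
  \<comment> \<open>The commutator of \<open>\<theta> l\<close> and \<open>D\<close> differentiates
    only the coefficients of \<open>D\<close>. Row \<open>s\<close> of the updated Jacobian is thus
    row \<open>s\<close> of \<open>U ** B\<close> plus \<open>D\<close> applied to row
    \<open>s\<close> of \<open>U\<close>.\<close>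
  have comm: "\<theta> l (D x) = (\<Sum>j\<in>UNIV. \<theta> j x * \<theta> l (c j)) + D (\<theta> l x)" for l x
    by (simp add: D derivation_sum[OF deriv] derivation_mult[OF deriv] sum.distrib commute[of l] algebra_simps)
  have row: "jac (u(s := D (u s))) =
      det (\<chi> k. if k = s then (U ** B) $ k else U $ k) +
      det (\<chi> k. if k = s then (\<chi> l. D (U $ s $ l)) else U $ k)" for s
  proof -
    have "jac (u(s := D (u s))) =
      det (\<chi> k. if k = s then (U ** B) $ k + (\<chi> l. D (U $ s $ l)) else U $ k)"
      unfolding jac_def
      by (intro arg_cong[where f = det])
        (auto simp: vec_eq_iff U_def B_def comm matrix_matrix_mult_def)
    then show ?thesis by (simp add: det_row_add)
  qed
  have "trace B = 0" using c by (simp add: trace_def B_def)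
  then have "(\<Sum>s\<in>UNIV. jac (u(s := D (u s)))) = D (det U)"
    unfolding row sum.distrib sum_det_replace_row_mult derivation_det[OF derD] by simp
  then show ?thesis by (simp add: jac_def U_def)
qed

end

interpretation euler: commuting_derivations
  "euler :: 'n \<Rightarrow> ('n::{finite,linorder}, 'k::field_char_0) ratfun \<Rightarrow> _"
  by unfold_locales (fact derivation_euler euler_commute ratfun_double_eq_0)+

section \<open>The \<open>q\<close>-skew bracket\<close>

text \<open>Column \<open>j\<close> of the Euler Jacobian is \<open>t\<^sub>j\<close> times that of
  the ordinary one, so the factor \<open>t\<^sub>1 \<cdots> t\<^sub>n\<close> of the bracket is
  absorbed into the derivations.\<close>

definition log_jacobian_bracket ::
  "'k::field_char_0 \<Rightarrow> ('n::{finite,linorder} \<Rightarrow> ('n, 'k) ratfun) \<Rightarrow> ('n, 'k) ratfun" where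
  "log_jacobian_bracket q u = ratfun_scale q (euler.jac u)"

lemma log_jacobian_bracket_var:
  "log_jacobian_bracket q ratfun_var = ratfun_scale q (\<Prod>i\<in>UNIV. ratfun_var i)"
  unfolding log_jacobian_bracket_def euler.jac_def
  by (subst det_diagonal) (auto simp: euler_var)

lemma linear_ratfun_scaleI:
  assumes "derivation D" "\<And>c. D (ratfun_const c) = 0"
  shows "Vector_Spaces.linear ratfun_scale ratfun_scale D"
  unfolding Vector_Spaces.linear_iff using vector_space_ratfun_scale
  by (simp add: assms ratfun_scale_def derivation_add derivation_mult)

lemma derivation_const_mult:
  fixes c :: "'a::comm_ring_1"
  shows "derivation D \<Longrightarrow> derivation (\<lambda>x. c * D x)"
  by (rule derivationI) (simp_all add: derivation_add derivation_mult algebra_simps)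

lemma nambu_poisson_log_jacobian_bracket:
  "nambu_poisson_algebra ratfun_scale
    (log_jacobian_bracket q :: ('n::{finite,linorder} \<Rightarrow> ('n, 'k::field_char_0) ratfun) \<Rightarrow> _)"
proof (intro nambu_poisson_algebra.intro vector_space_ratfun_scale nambu_poisson_algebra_axioms.intro)
  fix u v :: "'n \<Rightarrow> ('n, 'k) ratfun" and i j :: 'n and x y :: "('n, 'k) ratfun" and c :: 'k
  have der: "derivation (\<lambda>x. log_jacobian_bracket q (u(i := x)))"
    unfolding log_jacobian_bracket_def ratfun_scale_def
    by (intro derivation_const_mult euler.derivation_jac)
  show "ratfun_scale c (x * y) = ratfun_scale c x * y"
    by (simp add: ratfun_scale_def)
  show "Vector_Spaces.linear ratfun_scale ratfun_scale (\<lambda>x. log_jacobian_bracket q (u(i := x)))"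
    by (rule linear_ratfun_scaleI[OF der])
      (simp add: log_jacobian_bracket_def ratfun_scale_def euler.jac_update)
  show "log_jacobian_bracket q u = 0" if "i \<noteq> j" "u i = u j"
    using euler.jac_alternating[OF that] by (simp add: log_jacobian_bracket_def ratfun_scale_def)
  show "log_jacobian_bracket q (u(i := x * y)) =
      x * log_jacobian_bracket q (u(i := y)) + log_jacobian_bracket q (u(i := x)) * y"
    by (rule derivation_mult[OF der])
  \<comment> \<open>For fixed \<open>v\<close> the bracket is a derivation in its first argument,
    with coefficients \<open>q\<close> times cofactors. The fundamental identity says that it acts
    on the bracket of \<open>u\<close> argument by argument.\<close>
  define D where "D x = log_jacobian_bracket q (v(first_index := x))" for x
  have D_const: "D (ratfun_const c * x) = ratfun_const c * D x" for c x
    unfolding D_def log_jacobian_bracket_def ratfun_scale_def euler.jac_update euler_const_mult sum_distrib_left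
    by (simp add: mult_ac)
  have "D (euler.jac u) = (\<Sum>s\<in>UNIV. euler.jac (u(s := D (u s))))"
  proof (rule euler.jac_divergence_free)
    \<comment> \<open>The constant \<open>q\<close> passes through the Euler derivations, leaving
      the divergence of the cofactors.\<close>
    show "(\<Sum>k\<in>UNIV. euler k (ratfun_const q * euler.jac_cofactor v first_index k)) = 0"
      by (simp add: euler_const_mult euler.jac_cofactor_divergence flip: sum_distrib_left)
    show "D x = (\<Sum>j\<in>UNIV. ratfun_const q * euler.jac_cofactor v first_index j * euler j x)" for x
      by (simp add: D_def log_jacobian_bracket_def ratfun_scale_def euler.jac_update
          sum_distrib_left algebra_simps)
  qed
  then show "log_jacobian_bracket q (v(first_index := log_jacobian_bracket q u)) =
    (\<Sum>s\<in>UNIV. log_jacobian_bracket q (u(s := log_jacobian_bracket q (v(first_index := u s)))))"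
    unfolding D_def[symmetric]
    by (simp add: log_jacobian_bracket_def ratfun_scale_def D_const sum_distrib_left)
qed

lemma alternating_multiderivation_eq_0:
  fixes E :: "('n::{finite,linorder} \<Rightarrow> ('n, 'k::field) ratfun) \<Rightarrow> ('n, 'k) ratfun"
  assumes der: "\<And>u i. derivation (\<lambda>x. E (u(i := x)))"
    and const: "\<And>u i c. E (u(i := ratfun_const c)) = 0"
    and alt: "\<And>u i j. i \<noteq> j \<Longrightarrow> u i = u j \<Longrightarrow> E u = 0"
    and var: "E ratfun_var = 0"
  shows "E u = 0"
proof -
  have E_swap: "E (u \<circ> Transposition.transpose a b) = - E u" if "a \<noteq> b" for u a b
  proof -
    let ?F = "\<lambda>x y. E (u(a := x, b := y))"
    have add2: "?F x (y + z) = ?F x y + ?F x z" for x y z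
      by (rule derivation_add[OF der])
    have add1: "?F (x + y) z = ?F x z + ?F y z" for x y z
      using derivation_add[OF der[of "u(b := z)" a], of x y] that by (simp add: fun_upd_twist)
    have diag: "?F x x = 0" for x
      by (rule alt[OF that]) (use that in simp)
    \<comment> \<open>Polarization: expand the vanishing value of \<open>?F\<close> at
      \<open>x + y\<close> in both positions.\<close>
    have "?F x y + ?F y x = 0" for x y
      using diag[of "x + y"] unfolding add1 add2 by (simp add: diag add.commute)
    from this[of "u a" "u b"] have "E u + E (u(a := u b, b := u a)) = 0"
      by simp
    moreover have "u(a := u b, b := u a) = u \<circ> Transposition.transpose a b"
      by (auto simp: Transposition.transpose_def)
    ultimately show ?thesis by (simp add: add_eq_0_iff)
  qed
  have "\<forall>u. E u = 0 \<longrightarrow> E (u \<circ> p) = 0" if "p permutes UNIV" for p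
    using that finite[of "UNIV :: 'n set"]
  proof (induction rule: permutes_induct)
    case (swap a b p)
    show ?case
    proof (intro allI impI)
      fix u assume "E u = 0"
      then have 0: "E (u \<circ> Transposition.transpose a b) = 0" using E_swap[OF swap.hyps(3)] by simp
      then show "E (u \<circ> (Transposition.transpose a b \<circ> p)) = 0"
        using swap.IH[rule_format, OF 0] by (simp only: comp_assoc)
    qed
  qed simp
  then have perm: "E (ratfun_var \<circ> p) = 0" if "p permutes UNIV" for p
    using that var by simp
  have vars: "E (ratfun_var \<circ> \<sigma>) = 0" for \<sigma>
  proof (cases "inj \<sigma>")
    case True
    then have "\<sigma> permutes UNIV"
      by (intro bij_imp_permutes bijI finite_UNIV_inj_surj) auto
    then show ?thesis by (rule perm)
  next
    case False
    then obtain i j where "i \<noteq> j" "\<sigma> i = \<sigma> j" by (auto simp: inj_def)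
    then show ?thesis by (intro alt[of i j]) auto
  qed
  \<comment> \<open>\<open>S\<close> is the set of positions already freed from holding a
    variable.\<close>
  have "\<forall>u. (\<forall>i. i \<notin> S \<longrightarrow> u i \<in> range ratfun_var) \<longrightarrow> E u = 0" for S :: "'n set"
    using finite[of S]
  proof (induction S rule: finite_induct)
    case empty
    show ?case
    proof (intro allI impI)
      fix u :: "'n \<Rightarrow> ('n, 'k) ratfun" assume "\<forall>i. i \<notin> {} \<longrightarrow> u i \<in> range ratfun_var"
      then have "\<forall>i. \<exists>j. u i = ratfun_var j" by blast
      then obtain \<sigma> where "\<And>i. u i = ratfun_var (\<sigma> i)" by metis
      then have "u = ratfun_var \<circ> \<sigma>" by auto
      then show "E u = 0" using vars by simp
    qed
  next
    case (insert i S)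
    show ?case
    proof (intro allI impI)
      fix u :: "'n \<Rightarrow> ('n, 'k) ratfun" assume u: "\<forall>j. j \<notin> insert i S \<longrightarrow> u j \<in> range ratfun_var"
      have "E (u(i := ratfun_var k)) = 0" for k
        by (rule insert.IH[rule_format]) (use u in auto)
      then have "E (u(i := x)) = 0" for x
        by (rule ratfun_derivation_eq_0[OF der const])
      from this[of "u i"] show "E u = 0" by simp
    qed
  qed
  from this[of UNIV] show ?thesis by simp
qed

context nambu_poisson_algebra
begin

lemma derivation_br: "derivation (\<lambda>x. br (u(i := x)))"
proof (rule derivationI)
  show "br (u(i := x + y)) = br (u(i := x)) + br (u(i := y))" for x y
    using multilinear[of u i] unfolding Vector_Spaces.linear_iff by blast
qed (rule leibniz)

lemma br_scale_1: "br (u(i := scale c 1)) = 0"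
proof -
  have "br (u(i := scale c 1)) = scale c (br (u(i := 1)))"
    using multilinear[of u i] unfolding Vector_Spaces.linear_iff by blast
  then show ?thesis by (simp add: derivation_1[OF derivation_br])
qed

end

text \<open>Resolves the definite description: the Jacobian formula gives existence, and the
  difference of any other solution from it is an alternating multiderivation that vanishes on the
  variables.\<close>

lemma qskew_bracket_eq:
  "(qskew_bracket q :: ('n::{finite,linorder} \<Rightarrow> ('n, 'k::field_char_0) ratfun) \<Rightarrow> _) = log_jacobian_bracket q"
  unfolding qskew_bracket_def
proof (rule the_equality)
  show "nambu_poisson_algebra ratfun_scale (log_jacobian_bracket q) \<and>
      log_jacobian_bracket q ratfun_var = ratfun_scale q (\<Prod>i\<in>UNIV. ratfun_var i)"
    by (simp add: nambu_poisson_log_jacobian_bracket log_jacobian_bracket_var)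
next
  fix br :: "('n \<Rightarrow> ('n, 'k) ratfun) \<Rightarrow> ('n, 'k) ratfun"
  assume *: "nambu_poisson_algebra ratfun_scale br \<and> br ratfun_var = ratfun_scale q (\<Prod>i\<in>UNIV. ratfun_var i)"
  then interpret br: nambu_poisson_algebra ratfun_scale br by simp
  interpret jb: nambu_poisson_algebra ratfun_scale "log_jacobian_bracket q :: ('n \<Rightarrow> ('n, 'k) ratfun) \<Rightarrow> _"
    by (rule nambu_poisson_log_jacobian_bracket)
  have const: "ratfun_const c = ratfun_scale c 1" for c :: 'k
    by (simp add: ratfun_scale_def)
  have "br u - log_jacobian_bracket q u = 0" for u
  proof (rule alternating_multiderivation_eq_0[where E = "\<lambda>u. br u - log_jacobian_bracket q u"])
    show "derivation (\<lambda>x. br (u(i := x)) - log_jacobian_bracket q (u(i := x)))" for u i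
      by (intro derivation_minus_derivation br.derivation_br jb.derivation_br)
    show "br (u(i := ratfun_const c)) - log_jacobian_bracket q (u(i := ratfun_const c)) = 0" for u i c
      by (simp add: const br.br_scale_1 jb.br_scale_1)
    show "br u - log_jacobian_bracket q u = 0" if "i \<noteq> j" "u i = u j" for u i j
      using br.alternating[OF that] jb.alternating[OF that] by simp
    show "br ratfun_var - log_jacobian_bracket q ratfun_var = 0"
      using * by (simp add: log_jacobian_bracket_var)
  qed
  then show "br = log_jacobian_bracket q" by auto
qed

section \<open>Residues of logarithmic derivatives\<close>

text \<open>
  The coefficient \<open>a\<close> at the bound \<open>m\<close> may be \<open>0\<close>; this makes the predicate additive. \<open>has_residue x r\<close> says
  that \<open>x\<close> is \<open>r\<close> plus terms of lower order.
\<close>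

definition bounded_lead :: "('m::linorder \<Rightarrow>\<^sub>0 'k::zero) \<Rightarrow> 'm \<Rightarrow> 'k \<Rightarrow> bool" where
  "bounded_lead p m a \<longleftrightarrow> (\<forall>k\<in>Poly_Mapping.keys p. k \<le> m) \<and> Poly_Mapping.lookup p m = a"

lemma bounded_lead_single: "bounded_lead (Poly_Mapping.single m a) m a"
  by (simp add: bounded_lead_def)

lemma bounded_lead_exists:
  assumes "p \<noteq> 0"
  obtains m a where "bounded_lead p m a" "a \<noteq> 0"
proof -
  have ne: "Poly_Mapping.keys p \<noteq> {}" using assms by auto
  have "bounded_lead p (Max (Poly_Mapping.keys p)) (Poly_Mapping.lookup p (Max (Poly_Mapping.keys p)))"
    by (simp add: bounded_lead_def)
  moreover have "Poly_Mapping.lookup p (Max (Poly_Mapping.keys p)) \<noteq> 0"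
    using Max_in[OF finite_keys ne] by (simp add: in_keys_iff)
  ultimately show ?thesis by (rule that)
qed

lemma bounded_lead_add:
  fixes p q :: "'m::linorder \<Rightarrow>\<^sub>0 'k::monoid_add"
  shows "bounded_lead p m a \<Longrightarrow> bounded_lead q m b \<Longrightarrow> bounded_lead (p + q) m (a + b)"
  using keys_add[of p q] by (auto simp: bounded_lead_def lookup_add)

lemma bounded_lead_diff:
  fixes p q :: "'m::linorder \<Rightarrow>\<^sub>0 'k::ab_group_add"
  assumes "bounded_lead p m a" "bounded_lead q m b"
  shows "bounded_lead (p - q) m (a - b)"
proof -
  have "Poly_Mapping.keys (p - q) \<subseteq> Poly_Mapping.keys p \<union> Poly_Mapping.keys q"
    by (auto simp: in_keys_iff lookup_minus)
  then show ?thesis using assms by (auto simp: bounded_lead_def lookup_minus)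
qed

text \<open>Only the pair of exponents \<open>m\<close> and \<open>n\<close> can contribute at
  \<open>m + n\<close>: for \<open>l < m\<close> in the support of \<open>p\<close>, a partner
  \<open>r \<le> n\<close> gives \<open>l + r < m + n\<close>.\<close>

lemma bounded_lead_mult:
  fixes p q :: "'m::{ordered_cancel_comm_monoid_add,linorder} \<Rightarrow>\<^sub>0 'k::semiring_0"
  assumes p: "bounded_lead p m a" and q: "bounded_lead q n b"
  shows "bounded_lead (p * q) (m + n) (a * b)"
proof -
  have "k \<le> m + n" if "k \<in> Poly_Mapping.keys (p * q)" for k
    using that keys_mult[of p q] p q by (auto simp: bounded_lead_def intro: add_mono)
  moreover have "Poly_Mapping.lookup (p * q) (m + n) = a * b"
  proof -
    have inner: "Poly_Mapping.lookup p l * (\<Sum>r. Poly_Mapping.lookup q r when m + n = l + r) = (a * b when l = m)" for l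
    proof (cases "l = m")
      case True
      then show ?thesis using p q by (simp add: bounded_lead_def)
    next
      case False
      show ?thesis
      proof (cases "l \<in> Poly_Mapping.keys p")
        case True
        then have "l < m" using p False by (auto simp: bounded_lead_def)
        have "(Poly_Mapping.lookup q r when m + n = l + r) = 0" for r
        proof (cases "m + n = l + r \<and> r \<in> Poly_Mapping.keys q")
          case True
          then have "l + r < m + n" using \<open>l < m\<close> q by (intro add_less_le_mono) (auto simp: bounded_lead_def)
          with True show ?thesis by simp
        qed (auto simp: in_keys_iff)
        then show ?thesis using False by simp
      next
        case F: False
        then show ?thesis using False by (simp add: in_keys_iff)
      qed
    qed
    show ?thesis by (simp add: lookup_mult inner)
  qed
  ultimately show ?thesis by (simp add: bounded_lead_def)
qed

lemma bounded_lead_poly_euler: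
  "bounded_lead p m a \<Longrightarrow> bounded_lead (poly_euler j p) m (of_nat (Poly_Mapping.lookup m j) * a)"
  by (auto simp: bounded_lead_def lookup_poly_euler in_keys_iff)

definition has_residue :: "('n::{finite,linorder}, 'k::field) ratfun \<Rightarrow> 'k \<Rightarrow> bool" where
  "has_residue x r \<longleftrightarrow>
    (\<exists>p d m b. b \<noteq> 0 \<and> bounded_lead p m (r * b) \<and> bounded_lead d m b \<and> x = Fract p d)"

lemma has_residueI:
  "bounded_lead p m c \<Longrightarrow> bounded_lead d m b \<Longrightarrow> b \<noteq> 0 \<Longrightarrow> c = r * b \<Longrightarrow> has_residue (Fract p d) r"
  unfolding has_residue_def by blast

lemma has_residueE:
  assumes "has_residue x r"
  obtains p d m b where "b \<noteq> 0" "d \<noteq> 0" "bounded_lead p m (r * b)" "bounded_lead d m b" "x = Fract p d"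
proof -
  obtain p d m b where *: "b \<noteq> 0" "bounded_lead p m (r * b)" "bounded_lead d m b" "x = Fract p d"
    using assms unfolding has_residue_def by blast
  then have "d \<noteq> 0" by (auto simp: bounded_lead_def)
  with * show ?thesis by (intro that)
qed

lemma has_residue_const: "has_residue (ratfun_const c) c"
  unfolding ratfun_const_def
  by (rule has_residueI[OF bounded_lead_single, of _ 0 1]) (simp_all add: bounded_lead_def lookup_one)

text \<open>Clear the denominator, compare coefficients at \<open>m\<close> and cancel
  \<open>b\<close>.\<close>

lemma has_residue_const_unique:
  assumes "has_residue (ratfun_const c :: ('n::{finite,linorder}, 'k::field) ratfun) r"
  shows "c = r"
proof -
  obtain p d :: "('n \<Rightarrow>\<^sub>0 nat) \<Rightarrow>\<^sub>0 'k" and m b where *: "b \<noteq> 0" "d \<noteq> 0" "bounded_lead p m (r * b)" "bounded_lead d m b"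
    "(ratfun_const c :: ('n, 'k) ratfun) = Fract p d"
    using assms by (rule has_residueE)
  then have "p = Poly_Mapping.single 0 c * d"
    by (simp add: ratfun_const_def eq_fract)
  moreover have "bounded_lead (Poly_Mapping.single 0 c * d) (0 + m) (c * b)"
    using * by (intro bounded_lead_mult bounded_lead_single)
  ultimately show ?thesis using * by (simp add: bounded_lead_def)
qed

text \<open>The elements with a residue form the valuation ring of the monomial order, and the
  residue is reduction modulo its maximal ideal. Compatibility with sums and products lets
  determinants be reduced entrywise.\<close>

lemma has_residue_add:
  assumes "has_residue x r" "has_residue y s"
  shows "has_residue (x + y) (r + s)"
proof -
  obtain p d m b where x: "b \<noteq> 0" "d \<noteq> 0" "bounded_lead p m (r * b)" "bounded_lead d m b" "x = Fract p d"
    using assms(1) by (rule has_residueE)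
  obtain q e n c where y: "c \<noteq> 0" "e \<noteq> 0" "bounded_lead q n (s * c)" "bounded_lead e n c" "y = Fract q e"
    using assms(2) by (rule has_residueE)
  have "bounded_lead (p * e + q * d) (m + n) (r * b * c + s * c * b)"
    using bounded_lead_mult[OF x(3) y(4)] bounded_lead_mult[OF y(3) x(4)]
    by (intro bounded_lead_add) (simp_all add: add.commute)
  moreover have "bounded_lead (d * e) (m + n) (b * c)"
    using x y by (intro bounded_lead_mult)
  ultimately have "has_residue (Fract (p * e + q * d) (d * e)) (r + s)"
    by (rule has_residueI) (use x y in \<open>simp_all add: algebra_simps\<close>)
  then show ?thesis using x y by simp
qed

lemma has_residue_mult:
  assumes "has_residue x r" "has_residue y s"
  shows "has_residue (x * y) (r * s)"
proof -
  obtain p d m b where x: "b \<noteq> 0" "d \<noteq> 0" "bounded_lead p m (r * b)" "bounded_lead d m b" "x = Fract p d"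
    using assms(1) by (rule has_residueE)
  obtain q e n c where y: "c \<noteq> 0" "e \<noteq> 0" "bounded_lead q n (s * c)" "bounded_lead e n c" "y = Fract q e"
    using assms(2) by (rule has_residueE)
  have "has_residue (Fract (p * q) (d * e)) (r * s)"
    by (rule has_residueI[OF bounded_lead_mult[OF x(3) y(3)] bounded_lead_mult[OF x(4) y(4)]])
      (use x y in simp_all)
  then show ?thesis using x y by simp
qed

lemma has_residue_sum:
  "(\<And>i. i \<in> A \<Longrightarrow> has_residue (f i) (g i)) \<Longrightarrow> has_residue (sum f A) (sum g A)"
  by (induction A rule: infinite_finite_induct)
    (use has_residue_const[of 0] in \<open>auto intro: has_residue_add\<close>)

lemma has_residue_prod:
  "(\<And>i. i \<in> A \<Longrightarrow> has_residue (f i) (g i)) \<Longrightarrow> has_residue (prod f A) (prod g A)"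
  by (induction A rule: infinite_finite_induct)
    (use has_residue_const[of 1] in \<open>auto intro: has_residue_mult\<close>)

lemma has_residue_det:
  fixes A :: "('n::{finite,linorder}, 'k::field) ratfun ^ 'm ^ 'm"
  assumes "\<And>i j. has_residue (A $ i $ j) (M $ i $ j)"
  shows "has_residue (det A) (det M)"
proof -
  have sgn: "has_residue (of_int (sign p)) (of_int (sign p))" for p :: "'m \<Rightarrow> 'm"
    using has_residue_const[of 1] has_residue_const[of "-1"]
    by (cases p rule: sign_cases) (simp_all add: ratfun_const_minus)
  show ?thesis
    unfolding det_def by (intro has_residue_sum has_residue_mult has_residue_prod sgn assms)
qed

text \<open>For \<open>x = p / d\<close> the residue is the exponent of variable \<open>j\<close> in
  the leading monomial of \<open>p\<close> minus that in the leading monomial of \<open>d\<close>;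
  the leading coefficients cancel.\<close>

lemma has_residue_log_derivative:
  assumes "x \<noteq> 0"
  shows "\<exists>k::int. has_residue (euler j x / x) (of_int k)"
proof (cases x)
  case (Fract p d)
  then have "p \<noteq> 0" using assms by (auto simp: Zero_fract_def eq_fract)
  obtain m a where p: "bounded_lead p m a" "a \<noteq> 0" using \<open>p \<noteq> 0\<close> by (rule bounded_lead_exists)
  obtain n b where d: "bounded_lead d n b" "b \<noteq> 0" using Fract(2) by (rule bounded_lead_exists)
  let ?k = "int (Poly_Mapping.lookup m j) - int (Poly_Mapping.lookup n j)"
  \<comment> \<open>The common factor \<open>d\<close> is left uncancelled; numerator and
    denominator are then both bounded by \<open>m + n + n\<close>.\<close>
  have eq: "euler j x / x = Fract ((d * poly_euler j p - p * poly_euler j d) * d) ((d * d) * p)"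
    using Fract by (simp add: euler_def fract_deriv_Fract[OF derivation_poly_euler])
  have "bounded_lead (d * poly_euler j p) (m + n) (b * (of_nat (Poly_Mapping.lookup m j) * a))"
    using bounded_lead_mult[OF d(1) bounded_lead_poly_euler[OF p(1)]] by (simp add: add.commute)
  then have "bounded_lead ((d * poly_euler j p - p * poly_euler j d) * d) (m + n + n)
     ((b * (of_nat (Poly_Mapping.lookup m j) * a) - a * (of_nat (Poly_Mapping.lookup n j) * b)) * b)"
    by (intro bounded_lead_mult[OF bounded_lead_diff d(1)]
        bounded_lead_mult[OF p(1) bounded_lead_poly_euler[OF d(1)]])
  moreover have "bounded_lead ((d * d) * p) (m + n + n) (b * b * a)"
    using bounded_lead_mult[OF bounded_lead_mult[OF d(1) d(1)] p(1)] by (simp add: add_ac)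
  ultimately have "has_residue (euler j x / x) (of_int ?k)"
    unfolding eq by (rule has_residueI) (use p d in \<open>simp_all add: algebra_simps\<close>)
  then show ?thesis ..
qed

section \<open>Isomorphisms\<close>

lemma jac_log_derivatives:
  fixes f :: "'n::{finite,linorder} \<Rightarrow> ('n, 'k::field_char_0) ratfun"
  assumes "\<And>i. f i \<noteq> 0"
  shows "euler.jac f = (\<Prod>i\<in>UNIV. f i) * det (\<chi> i j. euler j (f i) / f i)"
proof -
  have "(\<chi> i j. euler j (f i)) = (\<chi> i. f i *s (\<chi> j. euler j (f i) / f i))"
    using assms by (simp add: vec_eq_iff)
  then show ?thesis
    unfolding euler.jac_def by (simp only: det_rows_mul)
qed

section \<open>Integrality of the ratio of the parameters\<close>

lemma ratio_is_integer_if_iso: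
  fixes q q' :: "'k::field_char_0"
  assumes "nambu_poisson_iso
      ratfun_scale (log_jacobian_bracket q :: ('n::{finite,linorder} \<Rightarrow> ('n, 'k) ratfun) \<Rightarrow> _)
      ratfun_scale (log_jacobian_bracket q') \<phi>"
  obtains z :: int where "q = q' * of_int z"
proof -
  have bij: "bij \<phi>" and lin: "Vector_Spaces.linear ratfun_scale ratfun_scale \<phi>"
    and one: "\<phi> 1 = 1" and mult: "\<And>x y. \<phi> (x * y) = \<phi> x * \<phi> y"
    and br: "\<And>u. \<phi> (log_jacobian_bracket q u) = log_jacobian_bracket q' (\<lambda>i. \<phi> (u i))"
    using assms unfolding nambu_poisson_iso_def by auto
  have scale: "\<phi> (ratfun_scale c x) = ratfun_scale c (\<phi> x)" for c x
    using lin by (simp add: Vector_Spaces.linear_iff)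
  have zero: "\<phi> 0 = 0" using scale[of 0 0] by (simp add: ratfun_scale_def)
  define f where "f i = \<phi> (ratfun_var i)" for i
  have f_nz: "f i \<noteq> 0" for i
    unfolding f_def using bij_is_inj[OF bij] zero by (metis injD ratfun_var_neq_0)
  have prod: "\<phi> (prod g A) = (\<Prod>i\<in>A. \<phi> (g i))" if "finite A" for g and A :: "'n set"
    using that by induction (simp_all add: one mult)
  let ?L = "(\<chi> i j. euler j (f i) / f i)"
  have "\<forall>i j. \<exists>k::int. has_residue (euler j (f i) / f i) (of_int k)"
    using has_residue_log_derivative[OF f_nz] by blast
  then obtain M :: "'n \<Rightarrow> 'n \<Rightarrow> int" where M: "\<And>i j. has_residue (euler j (f i) / f i) (of_int (M i j))"
    by metis
  \<comment> \<open>Compatibility of \<open>\<phi>\<close> with the bracket, evaluated on the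
    variables; the nonzero product of the \<open>f i\<close> occurs on both sides and
    cancels.\<close>
  have "ratfun_const q * (\<Prod>i\<in>UNIV. f i) = ratfun_const q' * ((\<Prod>i\<in>UNIV. f i) * det ?L)"
    using br[of ratfun_var]
    by (simp add: log_jacobian_bracket_var scale prod f_def[symmetric])
      (simp add: log_jacobian_bracket_def ratfun_scale_def jac_log_derivatives[OF f_nz])
  then have q: "ratfun_const q = ratfun_const q' * det ?L"
    using f_nz by simp
  have "has_residue (det ?L) (det (\<chi> i j. of_int (M i j)))"
    by (rule has_residue_det) (simp add: M)
  then have "has_residue (ratfun_const q :: ('n, 'k) ratfun) (q' * det (\<chi> i j. of_int (M i j)))"
    unfolding q by (intro has_residue_mult has_residue_const)
  then have "q = q' * det (\<chi> i j. of_int (M i j))"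
    by (rule has_residue_const_unique)
  also have "(det (\<chi> i j. of_int (M i j)) :: 'k) = of_int (det (\<chi> i j. M i j))"
    by (simp add: det_def)
  finally show ?thesis by (rule that)
qed

text \<open>Exchanges the roles of the two fields, so that the integrality result also yields
  \<open>q'\<close> as an integer multiple of \<open>q\<close>.\<close>

lemma nambu_poisson_iso_inv:
  assumes iso: "nambu_poisson_iso s1 br1 s2 br2 \<phi>"
  shows "nambu_poisson_iso s2 br2 s1 br1 (inv \<phi>)"
proof -
  have bij: "bij \<phi>" and lin: "Vector_Spaces.linear s1 s2 \<phi>"
    and one: "\<phi> 1 = 1" and mult: "\<And>x y. \<phi> (x * y) = \<phi> x * \<phi> y"
    and br: "\<And>u. \<phi> (br1 u) = br2 (\<lambda>i. \<phi> (u i))"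
    using iso unfolding nambu_poisson_iso_def by auto
  have [simp]: "\<phi> (inv \<phi> y) = y" for y by (simp add: bij bij_is_surj surj_f_inv_f)
  have eqI: "inv \<phi> y = x" if "y = \<phi> x" for x y by (simp add: that bij bij_is_inj inv_f_f)
  show ?thesis
    unfolding nambu_poisson_iso_def Vector_Spaces.linear_iff
    using lin bij_imp_bij_inv[OF bij]
    by (auto simp: Vector_Spaces.linear_iff one mult br intro!: eqI)
qed

lemma isomorphic_imp_eq_or_minus:
  fixes q q' :: "'k::field_char_0"
  assumes "nambu_poisson_isomorphic
      ratfun_scale (log_jacobian_bracket q :: ('n::{finite,linorder} \<Rightarrow> ('n, 'k) ratfun) \<Rightarrow> _)
      ratfun_scale (log_jacobian_bracket q' :: ('n \<Rightarrow> ('n, 'k) ratfun) \<Rightarrow> _)"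
    and "q \<noteq> 0"
  shows "q = q' \<or> q = - q'"
proof -
  obtain \<phi> where \<phi>: "nambu_poisson_iso ratfun_scale
      (log_jacobian_bracket q :: ('n \<Rightarrow> ('n, 'k) ratfun) \<Rightarrow> _) ratfun_scale (log_jacobian_bracket q') \<phi>"
    using assms(1) unfolding nambu_poisson_isomorphic_def by blast
  obtain z where z: "q = q' * of_int z" by (rule ratio_is_integer_if_iso[OF \<phi>])
  obtain w where w: "q' = q * of_int w" by (rule ratio_is_integer_if_iso[OF nambu_poisson_iso_inv[OF \<phi>]])
  \<comment> \<open>Characteristic \<open>0\<close> makes \<open>of_int\<close> injective, so
    \<open>w * z = 1\<close> holds among the integers and \<open>z\<close> is a unit there.\<close>
  have "q * of_int (w * z) = q * of_int 1" using z w by (simp add: mult.assoc)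
  then have "w * z = 1" using \<open>q \<noteq> 0\<close> by (simp only: mult_cancel_left of_int_eq_iff) simp
  then have "z = 1 \<or> z = -1" by (metis mult.commute zmult_eq_1_iff)
  then show ?thesis using z by auto
qed

section \<open>Permutation of variables and the isomorphism changing the sign\<close>

definition ratfun_permute :: "('n \<Rightarrow> 'n) \<Rightarrow> ('n::{finite,linorder}, 'k::field) ratfun \<Rightarrow> ('n, 'k) ratfun" where
  "ratfun_permute \<tau> = fract_map (poly_permute \<tau>)"

context
  fixes \<tau> :: "'n::{finite,linorder} \<Rightarrow> 'n"
  assumes invol: "\<And>i. \<tau> (\<tau> i) = i"
begin

lemma poly_permute_eq_0_iff: "poly_permute \<tau> (p :: ('n \<Rightarrow>\<^sub>0 nat) \<Rightarrow>\<^sub>0 'k::field) = 0 \<longleftrightarrow> p = 0"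
proof -
  have "poly_permute \<tau> 0 = (0 :: ('n \<Rightarrow>\<^sub>0 nat) \<Rightarrow>\<^sub>0 'k)"
    using poly_permute_single[OF invol, of 0 0] by simp
  then show ?thesis by (metis poly_permute_invol[OF invol])
qed

lemma ratfun_permute_Fract:
  "d \<noteq> 0 \<Longrightarrow> ratfun_permute \<tau> (Fract p d) = Fract (poly_permute \<tau> p) (poly_permute \<tau> d)"
  unfolding ratfun_permute_def
  by (rule fract_map_Fract) (simp_all add: poly_permute_mult[OF invol] poly_permute_eq_0_iff)

lemma ratfun_permute_add: "ratfun_permute \<tau> (x + y) = ratfun_permute \<tau> x + ratfun_permute \<tau> y"
  by (cases x, cases y)
    (simp add: ratfun_permute_Fract poly_permute_add[OF invol] poly_permute_mult[OF invol] poly_permute_eq_0_iff)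

lemma ratfun_permute_mult: "ratfun_permute \<tau> (x * y) = ratfun_permute \<tau> x * ratfun_permute \<tau> y"
  by (cases x, cases y)
    (simp add: ratfun_permute_Fract poly_permute_mult[OF invol] poly_permute_eq_0_iff)

lemma ratfun_permute_invol: "ratfun_permute \<tau> (ratfun_permute \<tau> x) = x"
  by (cases x) (simp add: ratfun_permute_Fract poly_permute_invol[OF invol] poly_permute_eq_0_iff)

lemma poly_permute_1: "poly_permute \<tau> (1 :: ('n \<Rightarrow>\<^sub>0 nat) \<Rightarrow>\<^sub>0 'k::field) = 1"
  using poly_permute_single[OF invol, of 0 "1::'k"] by (simp add: map_key_zero[OF inj_invol[OF invol]])

lemma ratfun_permute_const: "ratfun_permute \<tau> (ratfun_const c) = ratfun_const c"
  by (simp add: ratfun_const_def ratfun_permute_Fract poly_permute_single[OF invol] poly_permute_1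
      map_key_zero[OF inj_invol[OF invol]])

lemma ratfun_permute_0: "ratfun_permute \<tau> 0 = 0"
  using ratfun_permute_const[of 0] by simp

lemma ratfun_permute_1: "ratfun_permute \<tau> 1 = 1"
  using ratfun_permute_const[of 1] by simp

lemma ratfun_permute_var: "ratfun_permute \<tau> (ratfun_var i) = ratfun_var (\<tau> i)"
proof -
  have "Poly_Mapping.map_key \<tau> (Poly_Mapping.single i 1) = Poly_Mapping.single (\<tau> i) (1::nat)"
    using map_key_single[OF inj_invol[OF invol], of "\<tau> i" "1::nat"] by (simp add: invol)
  then show ?thesis
    by (simp add: ratfun_var_def ratfun_permute_Fract poly_permute_single[OF invol] poly_permute_1)
qed

lemma ratfun_permute_sum: "ratfun_permute \<tau> (sum f A) = (\<Sum>i\<in>A. ratfun_permute \<tau> (f i))"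
  by (induction A rule: infinite_finite_induct) (simp_all add: ratfun_permute_0 ratfun_permute_add)

lemma ratfun_permute_prod: "ratfun_permute \<tau> (prod f A) = (\<Prod>i\<in>A. ratfun_permute \<tau> (f i))"
  by (induction A rule: infinite_finite_induct) (simp_all add: ratfun_permute_1 ratfun_permute_mult)

lemma ratfun_permute_det:
  fixes A :: "('n, 'k::field) ratfun ^ 'm ^ 'm"
  shows "ratfun_permute \<tau> (det A) = det (\<chi> i j. ratfun_permute \<tau> (A $ i $ j))"
proof -
  have "ratfun_permute \<tau> (of_int (sign p)) = (of_int (sign p) :: ('n, 'k) ratfun)" for p :: "'m \<Rightarrow> 'm"
    using ratfun_permute_const[of "-1"]
    by (cases p rule: sign_cases) (simp_all add: ratfun_const_minus ratfun_permute_1)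
  then show ?thesis
    by (simp add: det_def ratfun_permute_sum ratfun_permute_mult ratfun_permute_prod)
qed

text \<open>Conjugating an Euler derivation by the substitution gives a derivation again, and the
  two sides agree on constants and variables.\<close>

lemma euler_ratfun_permute:
  "ratfun_permute \<tau> (euler (\<tau> j) (ratfun_permute \<tau> x)) = euler j x"
proof -
  have "derivation (\<lambda>x. ratfun_permute \<tau> (euler (\<tau> j) (ratfun_permute \<tau> x)))"
    by (rule derivationI)
      (simp_all add: ratfun_permute_add ratfun_permute_mult ratfun_permute_invol
        derivation_add[OF derivation_euler] derivation_mult[OF derivation_euler])
  then have "ratfun_permute \<tau> (euler (\<tau> j) (ratfun_permute \<tau> x)) - euler j x = 0"
  proof (rule ratfun_derivation_eq_0[OF derivation_minus_derivation[OF _ derivation_euler]])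
    have "\<tau> i = \<tau> j \<longleftrightarrow> i = j" for i by (metis invol)
    then show "ratfun_permute \<tau> (euler (\<tau> j) (ratfun_permute \<tau> (ratfun_const c))) - euler j (ratfun_const c) = 0"
      and "ratfun_permute \<tau> (euler (\<tau> j) (ratfun_permute \<tau> (ratfun_var i))) - euler j (ratfun_var i) = 0"
      for c :: 'a and i
      by (simp_all add: ratfun_permute_const ratfun_permute_var ratfun_permute_0 euler_var invol)
  qed
  then show ?thesis by simp
qed

text \<open>Moving the Euler derivations past the substitution permutes the columns of the Jacobian
  matrix by \<open>\<tau>\<close>, which produces the sign.\<close>

lemma jac_ratfun_permute:
  fixes u :: "'n \<Rightarrow> ('n, 'k::field_char_0) ratfun"
  shows "euler.jac (\<lambda>i. ratfun_permute \<tau> (u i)) = of_int (sign \<tau>) * ratfun_permute \<tau> (euler.jac u)"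
proof -
  have "\<tau> permutes UNIV"
    by (metis invol permutes_univ)
  have "euler j (ratfun_permute \<tau> x) = ratfun_permute \<tau> (euler (\<tau> j) x)" for j and x :: "('n, 'k) ratfun"
    using euler_ratfun_permute[of j "ratfun_permute \<tau> x"] by (simp add: ratfun_permute_invol)
  then have "euler.jac (\<lambda>i. ratfun_permute \<tau> (u i)) =
      det (\<chi> i j. (\<chi> i j. ratfun_permute \<tau> (euler j (u i))) $ i $ \<tau> j)"
    by (simp add: euler.jac_def)
  also have "\<dots> = of_int (sign \<tau>) * det (\<chi> i j. ratfun_permute \<tau> (euler j (u i)))"
    by (rule det_permute_columns) fact
  finally show ?thesis
    by (simp add: euler.jac_def ratfun_permute_det)
qed

end

text \<open>A transposition of variables is odd, so it multiplies the Jacobian by \<open>-1\<close>,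
  and this sign is absorbed into the parameter.\<close>

lemma isomorphic_minus:
  fixes q :: "'k::field_char_0"
  assumes "a \<noteq> (b::'n::{finite,linorder})"
  shows "nambu_poisson_isomorphic
      ratfun_scale (log_jacobian_bracket (- q) :: ('n \<Rightarrow> ('n, 'k) ratfun) \<Rightarrow> _)
      ratfun_scale (log_jacobian_bracket q :: ('n \<Rightarrow> ('n, 'k) ratfun) \<Rightarrow> _)"
proof -
  let ?\<tau> = "Transposition.transpose a b"
  let ?\<phi> = "ratfun_permute ?\<tau> :: ('n, 'k) ratfun \<Rightarrow> _"
  have invol: "?\<tau> (?\<tau> i) = i" for i by simp
  have "bij ?\<phi>"
    by (rule o_bij[of ?\<phi>]) (auto simp: ratfun_permute_invol[OF invol])
  moreover have "Vector_Spaces.linear ratfun_scale ratfun_scale ?\<phi>"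
    unfolding Vector_Spaces.linear_iff
    by (simp add: vector_space_ratfun_scale ratfun_scale_def ratfun_permute_add[OF invol]
        ratfun_permute_mult[OF invol] ratfun_permute_const[OF invol])
  moreover have "?\<phi> 1 = 1"
    by (rule ratfun_permute_1[OF invol])
  moreover have "?\<phi> (log_jacobian_bracket (- q) u) = log_jacobian_bracket q (\<lambda>i. ?\<phi> (u i))" for u
    by (simp add: log_jacobian_bracket_def ratfun_scale_def jac_ratfun_permute[OF invol]
        ratfun_permute_mult[OF invol] ratfun_permute_const[OF invol])
      (simp add: assms sign_swap_id ratfun_const_minus)
  ultimately have "nambu_poisson_iso ratfun_scale (log_jacobian_bracket (- q))
      ratfun_scale (log_jacobian_bracket q) ?\<phi>"
    unfolding nambu_poisson_iso_def by (simp add: ratfun_permute_mult[OF invol])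
  then show ?thesis unfolding nambu_poisson_isomorphic_def by blast
qed

lemma isomorphic_refl:
  "nambu_poisson_isomorphic
     ratfun_scale (br :: ('n::{finite,linorder} \<Rightarrow> ('n, 'k::field) ratfun) \<Rightarrow> _) ratfun_scale br"
proof -
  have "nambu_poisson_iso ratfun_scale br ratfun_scale br (\<lambda>x. x)"
    by (simp add: nambu_poisson_iso_def Vector_Spaces.linear_iff vector_space_ratfun_scale bij_def)
  then show ?thesis unfolding nambu_poisson_isomorphic_def by blast
qed

theorem theorem4p14:
  fixes q q' :: "'k::field_char_0"
  assumes "card (UNIV :: 'n::{finite,linorder} set) \<ge> 2"
    and "q \<noteq> 0" and "q' \<noteq> 0"
  shows "nambu_poisson_isomorphic
           ratfun_scale (qskew_bracket q :: ('n \<Rightarrow> ('n, 'k) ratfun) \<Rightarrow> ('n, 'k) ratfun)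
           ratfun_scale (qskew_bracket q' :: ('n \<Rightarrow> ('n, 'k) ratfun) \<Rightarrow> ('n, 'k) ratfun)
         \<longleftrightarrow> q = q' \<or> q = - q'"
proof -
  \<comment> \<open>At least two indices supply the pair of variables to be exchanged.\<close>
  have "\<not> card (UNIV :: 'n set) \<le> Suc 0"
    using assms(1) by simp
  then obtain a b :: 'n where "a \<noteq> b"
    by (auto simp: card_le_Suc0_iff_eq)
  show ?thesis
    unfolding qskew_bracket_eq
    using isomorphic_imp_eq_or_minus[of q q'] isomorphic_minus[OF \<open>a \<noteq> b\<close>, of q'] isomorphic_refl assms(2)
    by blast
qed

end
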